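(* Let $L(z)$ be an $n\times n$ $L$-operator over $\mathfrak R$, i.e. a matrix satisfying $R(z/w)L^{(1)}(z)L^{(2)}(w)=L^{(2)}(w)L^{(1)}(z)R(z/w)$ with the trigonometric $R$-matrix $R$. Then the $q$-determinant of $M=L(z)q^{2z\frac{\partial}{\partial z}}$ satisfies $$\det\nolimits_q M=\mathrm{qdet}\,L(z)\;q^{2nz\frac{\partial}{\partial z}},$$ where $\mathrm{qdet}\,L(z)$ is the quantum determinant of $L(z)$.
   Context: Let $q$ be a nonzero complex number and $\mathfrak R$ an associative unital, not necessarily commutative, algebra over $\mathbb C$. The $q$-determinant of an $n\times n$ matrix $M$ over a (noncommutative) algebra is $\det_q M=\sum_{\tau\in\mathfrak S_n}(-q)^{-\mathrm{inv}(\tau)}M_{\tau(1)1}M_{\tau(2)2}\cdots M_{\tau(n)n}$, where $\mathrm{inv}(\tau)$ is the number of inversions of $\tau$. The trigonometric $R$-matrix is $$R(z)=\frac1{z-1}\Big((qz-q^{-1})\sum_{i=1}^nE_{ii}\otimes E_{ii}+(z-1)\sum_{i\neq j}E_{ii}\otimes E_{jj}+(q-q^{-1})\sum_{i<j}\big(zE_{ij}\otimes E_{ji}+E_{ji}\otimes E_{ij}\big)\Big),$$ with $E_{ij}$ the matrix units of $\mathrm{End}(\mathbb C^n)$. $L(z)=\sum_{ij}L_{ij}(z)E_{ij}$ has entries in $\mathfrak R$ depending on the parameter $z$; $L^{(1)}(z)=\sum_{ij}L_{ij}(z)\,E_{ij}\otimes1$, $L^{(2)}(w)=\sum_{ij}L_{ij}(w)\,1\otimes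 E_{ij}$. The quantum determinant is $\mathrm{qdet}\,L(z)=\sum_{\tau\in\mathfrak S_n}(-q)^{-\mathrm{inv}(\tau)}L_{\tau(1)1}(z)L_{\tau(2)2}(q^2z)\cdots L_{\tau(n)n}(q^{2(n-1)}z)$. The operator $q^{2kz\frac{\partial}{\partial z}}$ acts by $f(z)\mapsto f(q^{2k}z)$, so in the algebra of operators generated by $\mathfrak R$-valued functions of $z$ and $q^{2z\frac{\partial}{\partial z}}$ one has $q^{2z\frac{\partial}{\partial z}}f(z)=f(q^2z)q^{2z\frac{\partial}{\partial z}}$; the entries of $M$ lie in this algebra. *)

theory Defs
  imports "HOL-Analysis.Analysis"
begin

class complex_algebra_1 = ring_1 +
  fixes scaleC :: "complex \<Rightarrow> 'a \<Rightarrow> 'a"  (infixr \<open>*\<^sub>C\<close> 75)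
  assumes scaleC_add_right: "c *\<^sub>C (x + y) = c *\<^sub>C x + c *\<^sub>C y"
    and scaleC_add_left: "(c + d) *\<^sub>C x = c *\<^sub>C x + d *\<^sub>C x"
    and scaleC_scaleC: "c *\<^sub>C d *\<^sub>C x = (c * d) *\<^sub>C x"
    and scaleC_one: "1 *\<^sub>C x = x"
    and mult_scaleC_left: "(c *\<^sub>C x) * y = c *\<^sub>C (x * y)"
    and mult_scaleC_right: "x * (c *\<^sub>C y) = c *\<^sub>C (x * y)"
begin

lemma scaleC_zero_right: "c *\<^sub>C 0 = 0"
  using scaleC_add_right[of c 0 0] by simp

lemma scaleC_minus_right: "c *\<^sub>C (- x) = - (c *\<^sub>C x)"
  using scaleC_add_right[of c x "- x"] by (simp add: scaleC_zero_right eq_neg_iff_add_eq_0 add.commute)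

lemma scaleC_diff_right: "c *\<^sub>C (x - y) = c *\<^sub>C x - c *\<^sub>C y"
  using scaleC_add_right[of c x "- y"] by (simp add: scaleC_minus_right)

definition of_complex :: "complex \<Rightarrow> 'a" where
  "of_complex c = c *\<^sub>C 1"

end


text \<open>
  The index set of a matrix is a finite linearly ordered type \<open>'n\<close>, which stands for
  \<open>{1, \<dots>, n}\<close> with \<open>n = CARD('n)\<close>. The element called \<open>j\<close> in \<open>{1, \<dots>, n}\<close> is the
  one with exactly \<open>j - 1\<close> elements below it, and products over the columns are ordered
  products from the least to the greatest index.
\<close>

definition inversions :: "('n::{finite,linorder} \<Rightarrow> 'n) \<Rightarrow> nat" where
  "inversions \<tau> = card {(i, j). i < j \<and> \<tau> j < \<tau> i}"

definition ordered_prod :: "('n::{finite,linorder} \<Rightarrow> 'a::monoid_mult) \<Rightarrow> 'a" where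
  "ordered_prod f = prod_list (map f (sorted_list_of_set UNIV))"

definition q_det :: "complex \<Rightarrow> 'a::complex_algebra_1 ^ 'n::{finite,linorder} ^ 'n::{finite,linorder} \<Rightarrow> 'a" where
  "q_det q M = (\<Sum>\<tau> | \<tau> permutes UNIV.
     ((- q) powi (- int (inversions \<tau>))) *\<^sub>C ordered_prod (\<lambda>j. M $ \<tau> j $ j))"

definition quantum_det ::
  "complex \<Rightarrow> (complex \<Rightarrow> 'a::complex_algebra_1 ^ 'n::{finite,linorder} ^ 'n::{finite,linorder}) \<Rightarrow> complex \<Rightarrow> 'a"
  where
  "quantum_det q L z = (\<Sum>\<tau> | \<tau> permutes UNIV.
     ((- q) powi (- int (inversions \<tau>))) *\<^sub>C
       ordered_prod (\<lambda>j. L (q ^ (2 * card {..<j}) * z) $ \<tau> j $ j))"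


definition matrix_unit :: "'n::finite \<Rightarrow> 'n \<Rightarrow> 'a::semiring_1 ^ 'n ^ 'n" where
  "matrix_unit i j = (\<chi> a b. if a = i \<and> b = j then 1 else 0)"

text \<open>
  Endomorphisms of \<open>\<complex>\<^sup>n \<otimes> \<complex>\<^sup>n\<close> with coefficients in an algebra are matrices whose rows and
  columns are indexed by pairs.
\<close>

definition tensor_matrix ::
  "'a::semiring_1 ^ 'n::finite ^ 'n \<Rightarrow> 'a ^ 'n ^ 'n \<Rightarrow> 'a ^ ('n \<times> 'n) ^ ('n \<times> 'n)"
  (infixr \<open>\<otimes>\<^sub>M\<close> 75) where
  "A \<otimes>\<^sub>M B = (\<chi> r c. A $ fst r $ fst c * B $ snd r $ snd c)"

definition R_matrix ::
  "complex \<Rightarrow> complex \<Rightarrow> complex ^ ('n::{finite,linorder} \<times> 'n) ^ ('n \<times> 'n)" where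
  "R_matrix q z = map_matrix ((*) (1 / (z - 1)))
     (map_matrix ((*) (q * z - inverse q))
        (\<Sum>i\<in>UNIV. matrix_unit i i \<otimes>\<^sub>M matrix_unit i i)
    + map_matrix ((*) (z - 1))
        (\<Sum>(i, j) | i \<noteq> j. matrix_unit i i \<otimes>\<^sub>M matrix_unit j j)
    + map_matrix ((*) (q - inverse q))
        (\<Sum>(i, j) | i < j. map_matrix ((*) z) (matrix_unit i j \<otimes>\<^sub>M matrix_unit j i)
                         + matrix_unit j i \<otimes>\<^sub>M matrix_unit i j))"

text \<open>
  \<open>D\<close> is the set of admissible values of the spectral parameter: a set of nonzero complex
  numbers, stable under multiplication by \<open>q\<^sup>2\<close>. It is \<open>\<complex> - {0}\<close> when \<open>L\<close> has no
  poles there. The values of \<open>L\<close> outside \<open>D\<close> carry no meaning. The case \<open>z = w\<close>, where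
  \<open>R(z/w)\<close> has its pole, is left out of the \<open>RLL\<close> relation.
\<close>

definition parameter_domain :: "complex \<Rightarrow> complex set \<Rightarrow> bool" where
  "parameter_domain q D \<longleftrightarrow> 0 \<notin> D \<and> (\<forall>z\<in>D. q\<^sup>2 * z \<in> D)"

definition L_operator ::
  "complex \<Rightarrow> complex set \<Rightarrow> (complex \<Rightarrow> 'a::complex_algebra_1 ^ 'n::{finite,linorder} ^ 'n::{finite,linorder}) \<Rightarrow> bool"
  where
  "L_operator q D L \<longleftrightarrow> (\<forall>z\<in>D. \<forall>w\<in>D. z \<noteq> w \<longrightarrow>
     map_matrix of_complex (R_matrix q (z / w)) ** (L z \<otimes>\<^sub>M mat 1) ** (mat 1 \<otimes>\<^sub>M L w)
     = (mat 1 \<otimes>\<^sub>M L w) ** (L z \<otimes>\<^sub>M mat 1) ** map_matrix of_complex (R_matrix q (z / w)))"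


text \<open>
  The algebra of all \<open>\<complex>\<close>-linear operators on \<open>'a\<close>-valued functions of \<open>z\<close>, with composition
  as product. It contains the multiplication operators (faithfully, since \<open>'a\<close> is unital)
  and the dilations \<open>q^(2kz \<partial>/\<partial>z)\<close>, hence the subalgebra generated by them. Functions are
  total; for a parameter domain \<open>D\<close> all products of these operators preserve the subspace of
  functions vanishing on \<open>D\<close>, so they act on the quotient by it, the functions on \<open>D\<close>.
\<close>

typedef (overloaded) 'a fun_operator =
  "{A :: (complex \<Rightarrow> 'a::complex_algebra_1) \<Rightarrow> (complex \<Rightarrow> 'a).
      (\<forall>f g. A (\<lambda>z. f z + g z) = (\<lambda>z. A f z + A g z)) \<and>
      (\<forall>c f. A (\<lambda>z. c *\<^sub>C f z) = (\<lambda>z. c *\<^sub>C A f z))}"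
  morphisms apply_op Abs_op
  by (rule exI[of _ id]) simp

setup_lifting type_definition_fun_operator

instantiation fun_operator :: (complex_algebra_1) complex_algebra_1
begin

lift_definition zero_fun_operator :: "'a fun_operator" is "\<lambda>f z. 0"
  by (simp add: scaleC_zero_right)

lift_definition one_fun_operator :: "'a fun_operator" is "\<lambda>f. f"
  by simp

lift_definition plus_fun_operator :: "'a fun_operator \<Rightarrow> 'a fun_operator \<Rightarrow> 'a fun_operator"
  is "\<lambda>A B f z. A f z + B f z"
  by (simp add: scaleC_add_right algebra_simps)

lift_definition minus_fun_operator :: "'a fun_operator \<Rightarrow> 'a fun_operator \<Rightarrow> 'a fun_operator"
  is "\<lambda>A B f z. A f z - B f z"
  by (simp add: scaleC_diff_right algebra_simps)

lift_definition uminus_fun_operator :: "'a fun_operator \<Rightarrow> 'a fun_operator"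
  is "\<lambda>A f z. - A f z"
  by (simp add: scaleC_minus_right)

lift_definition times_fun_operator :: "'a fun_operator \<Rightarrow> 'a fun_operator \<Rightarrow> 'a fun_operator"
  is "\<lambda>A B f. A (B f)"
  by simp

lift_definition scaleC_fun_operator :: "complex \<Rightarrow> 'a fun_operator \<Rightarrow> 'a fun_operator"
  is "\<lambda>c A f z. c *\<^sub>C A f z"
  by (simp add: scaleC_add_right scaleC_scaleC mult.commute)

instance
proof
  show "(0 :: 'a fun_operator) \<noteq> 1"
  proof transfer
    show "(\<lambda>f z. 0) \<noteq> (\<lambda>f :: complex \<Rightarrow> 'a. f)"
      by (metis zero_neq_one)
  qed
qed (transfer; simp add: fun_eq_iff algebra_simps scaleC_add_right scaleC_add_left
      scaleC_scaleC scaleC_one)+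

end

lift_definition mult_op :: "(complex \<Rightarrow> 'a::complex_algebra_1) \<Rightarrow> 'a fun_operator"
  is "\<lambda>g f z. g z * f z"
  by (simp add: algebra_simps mult_scaleC_right)

text \<open>\<open>dilation_op q k\<close> is \<open>q^(2kz \<partial>/\<partial>z)\<close>.\<close>

lift_definition dilation_op :: "complex \<Rightarrow> nat \<Rightarrow> 'a::complex_algebra_1 fun_operator"
  is "\<lambda>q k f z. f (q ^ (2 * k) * z)"
  by simp

end

theory Submission
  imports Defs
begin

text \<open>
  The identity holds summand by summand. Write \<open>T\<close> for \<open>dilation_op q 1\<close>, so that
  \<open>T f(z) = f(q\<^sup>2 z) T\<close>. In \<open>(f\<^sub>0 T) (f\<^sub>1 T) \<cdots> (f\<^sub>n\<^sub>-\<^sub>1 T)\<close> the function \<open>f\<^sub>i\<close> has exactly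
  \<open>i\<close> dilations to its left; moving all of them to the far right replaces \<open>f\<^sub>i(z)\<close> by
  \<open>f\<^sub>i(q\<^sup>2\<^sup>i z)\<close> and leaves \<open>T\<^sup>n\<close> (lemma \<open>prod_mult_op_dilation_op\<close>). For a permutation
  \<open>\<tau>\<close>, this turns the column-ordered product of the entries \<open>M\<^bsub>\<tau>(j) j\<^esub>\<close> into the product of
  the shifted entries of \<open>L\<close> occurring in the quantum determinant, because the column in
  position \<open>i\<close> is the one with \<open>i\<close> columns below it (lemma \<open>card_lessThan_sorted_nth\<close>).
  The coefficients \<open>(-q)\<^bsup>-inv(\<tau>)\<^esup>\<close> are the same on both sides, and \<open>mult_op\<close> is linear, so
  the common right factor \<open>T\<^sup>n\<close> can be taken out of the sum.
\<close>

lemma mult_op_one: "mult_op (\<lambda>z. 1) = 1"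
  by transfer simp

lemma mult_op_mult: "mult_op f * mult_op g = mult_op (\<lambda>z. f z * g z)"
  by transfer (simp add: mult.assoc)

lemma mult_op_scaleC: "mult_op (\<lambda>z. c *\<^sub>C f z) = c *\<^sub>C mult_op f"
  by transfer (simp add: mult_scaleC_left)

lemma mult_op_sum: "mult_op (\<lambda>z. \<Sum>a\<in>A. f a z) = (\<Sum>a\<in>A. mult_op (f a))"
proof (induction A rule: infinite_finite_induct)
  case (insert a A)
  have "mult_op (\<lambda>z. f a z + (\<Sum>a\<in>A. f a z)) = mult_op (f a) + mult_op (\<lambda>z. \<Sum>a\<in>A. f a z)"
    by transfer (simp add: distrib_right)
  with insert show ?case by simp
qed (transfer; simp)+

lemma dilation_op_zero: "dilation_op q 0 = 1"
  by transfer simp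

lemma dilation_op_mult: "dilation_op q k * dilation_op q l = dilation_op q (k + l)"
  by transfer (simp add: power_add algebra_simps)

lemma dilation_op_mult_op:
  "dilation_op q k * mult_op f = mult_op (\<lambda>z. f (q ^ (2 * k) * z)) * dilation_op q k"
  by transfer simp

text \<open>
  The last factor is the one that the induction splits off: at that point the dilations to
  its left are already collected into one, so a single commutation finishes the step.
\<close>

lemma prod_mult_op_dilation_op:
  "prod_list (map (\<lambda>i. mult_op (f i) * dilation_op q 1) [0..<n])
    = mult_op (\<lambda>z. prod_list (map (\<lambda>i. f i (q ^ (2 * i) * z)) [0..<n])) * dilation_op q n"
proof (induction n)
  case 0
  show ?case by (simp add: mult_op_one dilation_op_zero)
next
  case (Suc n)
  let ?P = "\<lambda>z. prod_list (map (\<lambda>i. f i (q ^ (2 * i) * z)) [0..<n])"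
  let ?g = "\<lambda>z. f n (q ^ (2 * n) * z)"
  have "prod_list (map (\<lambda>i. mult_op (f i) * dilation_op q 1) [0..<Suc n])
      = mult_op ?P * (dilation_op q n * mult_op (f n)) * dilation_op q 1"
    by (simp only: upt_Suc_append le0 map_append prod_list.append Suc list.map
          prod_list.Cons prod_list.Nil mult_1_right mult.assoc)
  also have "\<dots> = (mult_op ?P * mult_op ?g) * (dilation_op q n * dilation_op q 1)"
    by (simp only: dilation_op_mult_op mult.assoc)
  also have "\<dots> = mult_op (\<lambda>z. ?P z * ?g z) * dilation_op q (n + 1)"
    by (simp only: mult_op_mult dilation_op_mult)
  finally show ?case by simp
qed

lemma card_lessThan_sorted_nth:
  fixes i :: nat
  assumes "i < CARD('n::{finite,linorder})"
  shows "card {..<sorted_list_of_set (UNIV :: 'n set) ! i} = i"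
proof -
  define xs where "xs = sorted_list_of_set (UNIV :: 'n set)"
  have len: "length xs = CARD('n)" and set: "set xs = UNIV"
    and sorted: "sorted_wrt (<) xs" and dist: "distinct xs"
    by (simp_all add: xs_def)
  have less_iff: "xs ! k < xs ! i \<longleftrightarrow> k < i" if "k < length xs" for k
    using sorted_wrt_nth_less[OF sorted] that assms len
    by (metis less_asym less_irrefl linorder_neqE_nat)
  have "{..<xs ! i} = (!) xs ` {..<i}"
  proof (intro set_eqI iffI)
    fix j assume j: "j \<in> {..<xs ! i}"
    obtain k where "k < length xs" "j = xs ! k"
      using set by (metis UNIV_I in_set_conv_nth)
    with j less_iff show "j \<in> (!) xs ` {..<i}" by auto
  qed (use less_iff assms len in auto)
  moreover have "inj_on ((!) xs) {..<i}"
    using dist assms len by (auto intro!: inj_on_nth)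
  ultimately show ?thesis by (simp add: card_image xs_def)
qed

lemma ordered_prod_nth:
  fixes f :: "'n::{finite,linorder} \<Rightarrow> 'a::monoid_mult"
  shows "ordered_prod f
    = prod_list (map (\<lambda>i. f (sorted_list_of_set UNIV ! i)) [0..<CARD('n)])"
proof -
  define xs where "xs = sorted_list_of_set (UNIV :: 'n set)"
  have "length xs = CARD('n)" by (simp add: xs_def)
  then have "map f xs = map (\<lambda>i. f (xs ! i)) [0..<CARD('n)]"
    by (intro nth_equalityI) auto
  then show ?thesis by (simp add: ordered_prod_def xs_def)
qed

lemma ordered_prod_mult_op_dilation_op:
  fixes f :: "'n::{finite,linorder} \<Rightarrow> complex \<Rightarrow> 'a::complex_algebra_1"
  shows "ordered_prod (\<lambda>j. mult_op (f j) * dilation_op q 1)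
    = mult_op (\<lambda>z. ordered_prod (\<lambda>j. f j (q ^ (2 * card {..<j}) * z))) * dilation_op q CARD('n)"
proof -
  let ?x = "\<lambda>i. sorted_list_of_set (UNIV :: 'n set) ! i"
  have "map (\<lambda>i. f (?x i) (q ^ (2 * card {..<?x i}) * z)) [0..<CARD('n)]
      = map (\<lambda>i. f (?x i) (q ^ (2 * i) * z)) [0..<CARD('n)]" for z
    by (simp add: card_lessThan_sorted_nth)
  then show ?thesis
    by (simp only: ordered_prod_nth prod_mult_op_dilation_op)
qed

lemma scaleC_sum_mult_right:
  fixes x :: "'b \<Rightarrow> 'a::complex_algebra_1"
  shows "(\<Sum>a\<in>A. c a *\<^sub>C (x a * y)) = (\<Sum>a\<in>A. c a *\<^sub>C x a) * y"
  by (simp add: sum_distrib_right mult_scaleC_left)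

theorem proposition6p3:
  fixes q :: complex
    and D :: "complex set"
    and L :: "complex \<Rightarrow> 'r::complex_algebra_1 ^ 'n::{finite,linorder} ^ 'n::{finite,linorder}"
    and M :: "'r fun_operator ^ 'n::{finite,linorder} ^ 'n::{finite,linorder}"
  assumes "q \<noteq> 0"
    and "parameter_domain q D"
    and "L_operator q D L"
    and "M = (\<chi> i j. mult_op (\<lambda>z. L z $ i $ j) * dilation_op q 1)"
  shows "q_det q M = mult_op (quantum_det q L) * dilation_op q CARD('n)"
proof -
  let ?S = "{\<tau> :: 'n \<Rightarrow> 'n. \<tau> permutes UNIV}"
  let ?c = "\<lambda>\<tau> :: 'n \<Rightarrow> 'n. (- q) powi (- int (inversions \<tau>))"
  let ?P = "\<lambda>\<tau> z. ordered_prod (\<lambda>j. L (q ^ (2 * card {..<j}) * z) $ \<tau> j $ j)"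
  have "q_det q M
      = (\<Sum>\<tau>\<in>?S. ?c \<tau> *\<^sub>C ordered_prod (\<lambda>j. mult_op (\<lambda>z. L z $ \<tau> j $ j) * dilation_op q 1))"
    by (simp add: q_det_def assms(4))
  also have "\<dots> = (\<Sum>\<tau>\<in>?S. ?c \<tau> *\<^sub>C (mult_op (?P \<tau>) * dilation_op q CARD('n)))"
    by (simp only: ordered_prod_mult_op_dilation_op)
  also have "\<dots> = (\<Sum>\<tau>\<in>?S. ?c \<tau> *\<^sub>C mult_op (?P \<tau>)) * dilation_op q CARD('n)"
    by (rule scaleC_sum_mult_right)
  also have "(\<Sum>\<tau>\<in>?S. ?c \<tau> *\<^sub>C mult_op (?P \<tau>)) = mult_op (\<lambda>z. \<Sum>\<tau>\<in>?S. ?c \<tau> *\<^sub>C ?P \<tau> z)"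
    by (simp only: mult_op_sum mult_op_scaleC)
  also have "(\<lambda>z. \<Sum>\<tau>\<in>?S. ?c \<tau> *\<^sub>C ?P \<tau> z) = quantum_det q L"
    by (simp add: quantum_det_def fun_eq_iff)
  finally show ?thesis .
qed

end
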